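(* For every positive integer $r$ there is a positive integer $n_0$ such that for all $n\ge n_0$, the graph $H_n$ of $V$'s and $Y$'s in the complete binary tree $T_n$ (defined in the context) has path-chromatic number larger than $r$, i.e. $\operatorname{pchr}(H_n)>r$.
   Context: The complete binary tree $T_n$ has as vertices all binary strings of length at most $n$ (including the empty string, the root); as a graph, $x$ is adjacent to $x0$ and $x1$. A $V$ in $T_n$ is a path in $T_n$ between two distinct vertices $y,z$ such that the vertex of the path closest to the root lies strictly between $y$ and $z$ on the path; this vertex $x$ is the low point of the $V$ and $y,z$ are its endpoints. A $Y$ in $T_n$ is a subtree of $T_n$ with exactly three leaves such that the vertex of the subtree closest to the root is one of its three leaves; that leaf is the lowest leaf of the $Y$ and the other two are its upper leaves. The graph $H_n$ has as vertex set all $V$'s and all $Y$'s in $T_n$, with adjacency: two $V$'s are adjacent when an endpoint of one is the low point of the other; two $Y$'s are adjacent when one of the upper leaves of one of them is the lowest leaf of the other; a $Y$ and a $V$ are adjacent when one of the upper leaves of the $Y$ is the low point of the $V$. A path-decomposition of a graph $G$ is a path $P$ together with subsets (bags) $B_t\subseteq V(G)$, $t\in V(P)$, such that every vertex of $G$ lies in some bag, both ends of every edge lie together in some bag, and for each vertex $v$ of $G$ the set of $t$ with $v\in B_t$ induces a connected subpath of $P$. The chromatic number of a path-decomposition is the maximum over $t$ of the chromatic number of the subgraph of $G$ induced by $B_t$; the path-chromatic number $\operatorname{pchr}(G)$ is the minimum chromatic number of a path-decomposition of $G$. *)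

theory Defs
  imports Main
begin

text \<open>Undirected simple graphs; an edge is a two-element set of vertices.\<close>

datatype 'a ugraph = UGraph (verts: "'a set") (edges: "'a set set")

definition wf_ugraph :: "'a ugraph \<Rightarrow> bool" where
  "wf_ugraph G \<longleftrightarrow> (\<forall>e\<in>edges G. e \<subseteq> verts G \<and> card e = 2)"

definition subgraph :: "'a ugraph \<Rightarrow> 'a ugraph \<Rightarrow> bool" where
  "subgraph S G \<longleftrightarrow> wf_ugraph S \<and> verts S \<subseteq> verts G \<and> edges S \<subseteq> edges G"

definition induced :: "'a ugraph \<Rightarrow> 'a set \<Rightarrow> 'a ugraph" where
  "induced G X = UGraph (verts G \<inter> X) {e \<in> edges G. e \<subseteq> X}"

text \<open>A path is given by its sequence of vertices; a sequence and its reversal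
  have the same \<open>path_graph\<close>.\<close>

definition is_path :: "'a ugraph \<Rightarrow> 'a list \<Rightarrow> bool" where
  "is_path G p \<longleftrightarrow> p \<noteq> [] \<and> distinct p \<and> set p \<subseteq> verts G \<and>
     (\<forall>i. Suc i < length p \<longrightarrow> {p ! i, p ! Suc i} \<in> edges G)"

definition path_graph :: "'a list \<Rightarrow> 'a ugraph" where
  "path_graph p = UGraph (set p) {{p ! i, p ! Suc i} | i. Suc i < length p}"

definition graph_dist :: "'a ugraph \<Rightarrow> 'a \<Rightarrow> 'a \<Rightarrow> nat" where
  "graph_dist G u v =
     (LEAST k. \<exists>p. is_path G p \<and> hd p = u \<and> last p = v \<and> length p = Suc k)"

definition connected_graph :: "'a ugraph \<Rightarrow> bool" where
  "connected_graph G \<longleftrightarrow> verts G \<noteq> {} \<and>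
     (\<forall>u\<in>verts G. \<forall>v\<in>verts G. \<exists>p. is_path G p \<and> hd p = u \<and> last p = v)"

definition acyclic_graph :: "'a ugraph \<Rightarrow> bool" where
  "acyclic_graph G \<longleftrightarrow>
     \<not> (\<exists>p. is_path G p \<and> 3 \<le> length p \<and> {last p, hd p} \<in> edges G)"

definition is_tree :: "'a ugraph \<Rightarrow> bool" where
  "is_tree G \<longleftrightarrow> connected_graph G \<and> acyclic_graph G"

definition leaves :: "'a ugraph \<Rightarrow> 'a set" where
  "leaves G = {v \<in> verts G. card {e \<in> edges G. v \<in> e} = 1}"


text \<open>Chromatic and path-chromatic number, as natural numbers; these are meant for
  finite graphs, for which a colouring with finitely many colours exists.\<close>

definition proper_colouring :: "'a ugraph \<Rightarrow> nat \<Rightarrow> ('a \<Rightarrow> nat) \<Rightarrow> bool" where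
  "proper_colouring G k c \<longleftrightarrow> (\<forall>v\<in>verts G. c v < k) \<and>
     (\<forall>u\<in>verts G. \<forall>v\<in>verts G. {u, v} \<in> edges G \<longrightarrow> c u \<noteq> c v)"

definition chromatic_number :: "'a ugraph \<Rightarrow> nat" where
  "chromatic_number G = (LEAST k. \<exists>c. proper_colouring G k c)"

text \<open>The decomposition path has vertices \<open>0, \<dots>, length Bs - 1\<close> in this order, and
  \<open>Bs ! t\<close> is the bag at \<open>t\<close>.\<close>

definition path_decomposition :: "'a ugraph \<Rightarrow> 'a set list \<Rightarrow> bool" where
  "path_decomposition G Bs \<longleftrightarrow> Bs \<noteq> [] \<and>
     (\<forall>t<length Bs. Bs ! t \<subseteq> verts G) \<and>
     (\<forall>v\<in>verts G. \<exists>t<length Bs. v \<in> Bs ! t) \<and>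
     (\<forall>e\<in>edges G. \<exists>t<length Bs. e \<subseteq> Bs ! t) \<and>
     (\<forall>v\<in>verts G. \<forall>s t u. s \<le> t \<and> t \<le> u \<and> u < length Bs \<and>
        v \<in> Bs ! s \<and> v \<in> Bs ! u \<longrightarrow> v \<in> Bs ! t)"

definition decomposition_chr :: "'a ugraph \<Rightarrow> 'a set list \<Rightarrow> nat" where
  "decomposition_chr G Bs =
     Max ((\<lambda>t. chromatic_number (induced G (Bs ! t))) ` {..<length Bs})"

definition pchr :: "'a ugraph \<Rightarrow> nat" where
  "pchr G = (LEAST k. \<exists>Bs. path_decomposition G Bs \<and> decomposition_chr G Bs = k)"


text \<open>Binary strings are boolean lists, and the root is the empty list.\<close>

definition bin_tree :: "nat \<Rightarrow> bool list ugraph" where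
  "bin_tree n = UGraph {x. length x \<le> n} {{x, x @ [b]} | x b. length x < n}"

definition closest_to_root :: "nat \<Rightarrow> bool list ugraph \<Rightarrow> bool list \<Rightarrow> bool" where
  "closest_to_root n S x \<longleftrightarrow> x \<in> verts S \<and>
     (\<forall>v\<in>verts S. graph_dist (bin_tree n) [] x \<le> graph_dist (bin_tree n) [] v)"

text \<open>\<open>S\<close> is a V with low point \<open>x\<close> and set of endpoints \<open>E\<close>.\<close>

definition is_V :: "nat \<Rightarrow> bool list ugraph \<Rightarrow> bool list \<Rightarrow> bool list set \<Rightarrow> bool" where
  "is_V n S x E \<longleftrightarrow>
     (\<exists>p. is_path (bin_tree n) p \<and> S = path_graph p \<and> hd p \<noteq> last p \<and>
          E = {hd p, last p} \<and> closest_to_root n S x \<and> x \<notin> E)"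

text \<open>\<open>S\<close> is a Y with lowest leaf \<open>x\<close> and set of upper leaves \<open>U\<close>.\<close>

definition is_Y :: "nat \<Rightarrow> bool list ugraph \<Rightarrow> bool list \<Rightarrow> bool list set \<Rightarrow> bool" where
  "is_Y n S x U \<longleftrightarrow>
     subgraph S (bin_tree n) \<and> is_tree S \<and> card (leaves S) = 3 \<and>
     closest_to_root n S x \<and> x \<in> leaves S \<and> U = leaves S - {x}"

definition VV_adj :: "nat \<Rightarrow> bool list ugraph \<Rightarrow> bool list ugraph \<Rightarrow> bool" where
  "VV_adj n A B \<longleftrightarrow>
     (\<exists>x E x' E'. is_V n A x E \<and> is_V n B x' E' \<and> (x' \<in> E \<or> x \<in> E'))"

definition YY_adj :: "nat \<Rightarrow> bool list ugraph \<Rightarrow> bool list ugraph \<Rightarrow> bool" where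
  "YY_adj n A B \<longleftrightarrow>
     (\<exists>x U x' U'. is_Y n A x U \<and> is_Y n B x' U' \<and> (x' \<in> U \<or> x \<in> U'))"

definition YV_adj :: "nat \<Rightarrow> bool list ugraph \<Rightarrow> bool list ugraph \<Rightarrow> bool" where
  "YV_adj n A B \<longleftrightarrow> (\<exists>x U x' E'. is_Y n A x U \<and> is_V n B x' E' \<and> x' \<in> U)"

text \<open>No subgraph is both a V and a Y, as a V has two leaves and a Y has three, so
  the union of the two vertex classes is disjoint.\<close>

definition VY_graph :: "nat \<Rightarrow> bool list ugraph ugraph" where
  "VY_graph n = UGraph
     ({S. \<exists>x E. is_V n S x E} \<union> {S. \<exists>x U. is_Y n S x U})
     {{A, B} | A B. A \<noteq> B \<and> (VV_adj n A B \<or> YY_adj n A B \<or> YV_adj n A B)}"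

end

theory Submission
  imports Defs "HOL-Library.Sublist"
begin

text \<open>In a path-decomposition every vertex of the graph occupies an interval of times, and
  adjacent vertices occupy intersecting intervals. Suppose all bags are \<open>r\<close>-colourable.

  A tree vertex is early at time \<open>t\<close> if some V with that low point ends by \<open>t\<close>, and late if some
  such V starts no sooner than \<open>t\<close>. If it is neither, all its V's are in the bag at \<open>t\<close>, and a long
  chain of such vertices would give a shift graph of large chromatic number inside that bag. By the
  vertex Ramsey property of binary trees, every large embedded binary tree therefore has a switching
  time \<open>t\<close> at which it contains both an early and a late large embedded tree. Branching off at
  the vertex \<open>x\<close> that separates the two, each Y with one upper leaf in the early tree and one in the
  late tree is in the bag at \<open>t\<close>.

  For a vertex \<open>y\<close> and a time \<open>s\<close>, the Y's with upper leaf \<open>y\<close> are adjacent to those with lowest leaf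
  \<open>y\<close>; so either all of the former that live after \<open>s\<close> contain \<open>s\<close>, or all of the latter that live
  before \<open>s\<close> do. Turning towards the early or the late tree according to which of the two holds at
  \<open>y\<close>, and then in the opposite direction at the next separating vertex, yields nested time
  intervals along a chain of vertices. After thinning the chain so that the same alternative holds
  throughout, the Y's joining its vertices all lie in the bag of the innermost time and form a long
  shift graph, a contradiction.\<close>

section \<open>Paths and subtrees of the binary tree\<close>

text \<open>The subgraph that \<open>W\<close> induces in the infinite binary tree. Both
  \<open>bin_tree n\<close> and the Y's constructed below have this form and share its
  lemmas.\<close>

definition tree_on :: "bool list set \<Rightarrow> bool list ugraph" where
  "tree_on W = UGraph W {{v, v @ [b]} | v b. v \<in> W \<and> v @ [b] \<in> W}"

lemma verts_tree_on [simp]: "verts (tree_on W) = W"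
  by (simp add: tree_on_def)

lemma tree_on_edge_iff:
  "{u, v} \<in> edges (tree_on W) \<longleftrightarrow>
     u \<in> W \<and> v \<in> W \<and> ((\<exists>b. v = u @ [b]) \<or> (\<exists>b. u = v @ [b]))"
  by (auto simp: tree_on_def doubleton_eq_iff)

lemma bin_tree_eq_tree_on: "bin_tree n = tree_on {x. length x \<le> n}"
  unfolding bin_tree_def tree_on_def
  by (auto simp: Suc_le_eq intro: less_imp_le)

lemma is_path_iff_successively:
  "is_path G p \<longleftrightarrow> p \<noteq> [] \<and> distinct p \<and> set p \<subseteq> verts G \<and>
     successively (\<lambda>u v. {u, v} \<in> edges G) p"
  by (auto simp: is_path_def successively_conv_nth)

lemma prefix_one_step:
  assumes "prefix u v" "u \<noteq> v"
  obtains b where "prefix (u @ [b]) v"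
  using assms by (metis append_one_prefix prefix_length_less strict_prefix_def)

lemma ascending_path:
  assumes "prefix x y"
  obtains p where "p \<noteq> []" "distinct p" "hd p = x" "last p = y"
    "set p = {v. prefix x v \<and> prefix v y}" "successively (\<lambda>u v. \<exists>b. v = u @ [b]) p"
proof -
  obtain ys where y: "y = x @ ys" using assms by (auto simp: prefix_def)
  have "\<exists>p. p \<noteq> [] \<and> distinct p \<and> hd p = x \<and> last p = x @ ys \<and>
    set p = {v. prefix x v \<and> prefix v (x @ ys)} \<and> successively (\<lambda>u v. \<exists>b. v = u @ [b]) p"
  proof (induction ys rule: rev_induct)
    case Nil
    show ?case by (rule exI[of _ "[x]"]) (auto intro: prefix_order.antisym)
  next
    case (snoc b ys)
    then obtain p where p: "p \<noteq> []" "distinct p" "hd p = x" "last p = x @ ys"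
      "set p = {v. prefix x v \<and> prefix v (x @ ys)}" "successively (\<lambda>u v. \<exists>b. v = u @ [b]) p"
      by blast
    have eq: "prefix v (x @ ys @ [b]) \<longleftrightarrow> v = x @ ys @ [b] \<or> prefix v (x @ ys)" for v
      using prefix_snoc[of v "x @ ys" b] by simp
    have "x @ ys @ [b] \<notin> set p"
      unfolding p(5) by (auto dest: prefix_length_le)
    with p show ?case
      by (intro exI[of _ "p @ [x @ ys @ [b]]"])
         (auto simp: successively_append_iff eq)
  qed
  then show thesis unfolding y[symmetric] by (elim exE conjE) (rule that)
qed

text \<open>The ascending path to \<open>u\<close> is reversed and followed by the one to
  \<open>v\<close> without its first vertex; \<open>meet\<close> keeps the two halves
  disjoint.\<close>

lemma turning_path:
  assumes "prefix x u" "prefix x v"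
    and meet: "\<And>w. prefix x w \<Longrightarrow> prefix w u \<Longrightarrow> prefix w v \<Longrightarrow> w = x"
  obtains p where "p \<noteq> []" "distinct p" "hd p = u" "last p = v"
    "set p = {w. prefix x w \<and> (prefix w u \<or> prefix w v)}"
    "successively (\<lambda>u v. (\<exists>b. v = u @ [b]) \<or> (\<exists>b. u = v @ [b])) p"
proof -
  obtain p where p: "p \<noteq> []" "distinct p" "hd p = x" "last p = u"
    "set p = {w. prefix x w \<and> prefix w u}" "successively (\<lambda>u v. \<exists>b. v = u @ [b]) p"
    using ascending_path[OF assms(1)] by blast
  obtain q where q: "q \<noteq> []" "distinct q" "hd q = x" "last q = v"
    "set q = {w. prefix x w \<and> prefix w v}" "successively (\<lambda>u v. \<exists>b. v = u @ [b]) q"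
    using ascending_path[OF assms(2)] by blast
  obtain q' where q': "q = x # q'" using q(1,3) by (cases q) auto
  have set_q': "set q' = {w. prefix x w \<and> prefix w v \<and> w \<noteq> x}"
    using q(2,5) q' by auto
  have succ: "successively (\<lambda>u v. \<exists>b. v = u @ [b]) q'"
    "q' \<noteq> [] \<Longrightarrow> \<exists>b. hd q' = x @ [b]"
    using q(6) q' by (auto simp: successively_Cons)
  show thesis
  proof (rule that[of "rev p @ q'"])
    show "distinct (rev p @ q')"
      using p(2,5) q(2) q' set_q' meet by auto
    show "hd (rev p @ q') = u" using p by (simp add: hd_rev)
    show "last (rev p @ q') = v"
      using p q(4) q' by (cases q') (auto simp: last_rev)
    show "set (rev p @ q') = {w. prefix x w \<and> (prefix w u \<or> prefix w v)}"
      using p(5) set_q' assms(1) by auto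
    show "successively (\<lambda>u v. (\<exists>b. v = u @ [b]) \<or> (\<exists>b. u = v @ [b])) (rev p @ q')"
      using p(1,3,6) succ
      by (auto simp: successively_append_iff last_rev
          elim!: successively_mono)
  qed (use p in simp)
qed

lemma is_path_tree_onI:
  assumes "p \<noteq> []" "distinct p" "set p \<subseteq> W"
    "successively (\<lambda>u v. (\<exists>b. v = u @ [b]) \<or> (\<exists>b. u = v @ [b])) p"
  shows "is_path (tree_on W) p"
  unfolding is_path_iff_successively
  using assms by (auto simp: tree_on_edge_iff intro: successively_mono)

lemma graph_dist_bin_tree:
  assumes "length v \<le> n"
  shows "graph_dist (bin_tree n) [] v = length v"
  unfolding graph_dist_def
proof (rule Least_equality)
  obtain p where p: "p \<noteq> []" "distinct p" "hd p = []" "last p = v"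
    "set p = {w. prefix [] w \<and> prefix w v}" "successively (\<lambda>u v. \<exists>b. v = u @ [b]) p"
    using ascending_path[of "[]" v] by auto
  have "is_path (bin_tree n) p"
    unfolding bin_tree_eq_tree_on using p assms
    by (intro is_path_tree_onI) (auto dest: prefix_length_le elim!: successively_mono)
  moreover have "length p = Suc (length v)"
  proof -
    have "card (set p) = Suc (length v)"
    proof -
      have "set p = set (prefixes v)" using p(5) by auto
      then show ?thesis using distinct_card[OF distinct_prefixes[of v]] by simp
    qed
    then show ?thesis using distinct_card[OF p(2)] by simp
  qed
  ultimately show "\<exists>p. is_path (bin_tree n) p \<and> hd p = [] \<and> last p = v \<and> length p = Suc (length v)"
    using p by blast
next
  fix k
  assume "\<exists>p. is_path (bin_tree n) p \<and> hd p = [] \<and> last p = v \<and> length p = Suc k"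
  then obtain p where p: "is_path (bin_tree n) p" "hd p = []" "last p = v" "length p = Suc k"
    by blast
  \<comment> \<open>An edge changes the length of a string by one, so a path from the root gains at
    most one per step.\<close>
  have "i < length p \<Longrightarrow> length (p ! i) \<le> i" for i
  proof (induction i)
    case 0
    then show ?case using p(2) by (simp add: hd_conv_nth)
  next
    case (Suc i)
    have "{p ! i, p ! Suc i} \<in> edges (bin_tree n)"
      using p(1) Suc.prems by (simp add: is_path_def)
    then show ?case using Suc by (auto simp: bin_tree_eq_tree_on tree_on_edge_iff)
  qed
  from this[of k] show "length v \<le> k"
    using p(3,4) by (cases "p = []") (auto simp: last_conv_nth)
qed

text \<open>A longest string on a cycle can only have its parent as a neighbour there, but a cycle
  gives it two neighbours.\<close>

lemma acyclic_tree_on: "acyclic_graph (tree_on W)"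
  unfolding acyclic_graph_def
proof (intro notI, elim exE conjE)
  fix p
  assume p: "is_path (tree_on W) p" and len: "3 \<le> length p"
    and close: "{last p, hd p} \<in> edges (tree_on W)"
  let ?n = "length p"
  have dist: "distinct p" and ne: "p \<noteq> []" using p by (auto simp: is_path_def)
  have cyc: "{p ! i, p ! (Suc i mod ?n)} \<in> edges (tree_on W)" if "i < ?n" for i
  proof (cases "Suc i = ?n")
    case True
    then have "i = ?n - 1" "Suc i mod ?n = 0" by auto
    then have "p ! i = last p" "p ! (Suc i mod ?n) = hd p"
      using last_conv_nth[OF ne] hd_conv_nth[OF ne] by (simp_all only:)
    then show ?thesis using close by (simp only:)
  next
    case False
    then show ?thesis using that p by (simp add: is_path_def)
  qed
  have "Max (length ` set p) \<in> length ` set p" using ne by (intro Max_in) auto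
  then obtain m where m: "m \<in> set p" "Max (length ` set p) = length m" by (elim imageE)
  have longest: "length v \<le> length m" if "v \<in> set p" for v
    unfolding m(2)[symmetric] using that by (intro Max_ge) auto
  from m(1) obtain i where i: "i < ?n" "p ! i = m" by (auto simp: in_set_conv_nth)
  have parent: "v = butlast m" if "{m, v} \<in> edges (tree_on W)" "v \<in> set p" for v
    using that longest[of v] by (auto simp: tree_on_edge_iff)
  \<comment> \<open>Cyclic successor and predecessor of \<open>i\<close>; \<open>?n\<close> is added
    before subtracting because \<open>i\<close> may be \<open>0\<close>.\<close>
  let ?s = "Suc i mod ?n" and ?t = "(i + ?n - 1) mod ?n"
  have lt: "?s < ?n" "?t < ?n" using len by (auto intro!: mod_less_divisor)
  have t: "Suc ?t mod ?n = i"
  proof -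
    have "Suc ?t mod ?n = Suc (i + ?n - 1) mod ?n" by (rule mod_Suc_eq)
    also have "Suc (i + ?n - 1) = i + ?n" using len by simp
    finally show ?thesis using i by simp
  qed
  have "p ! ?s = butlast m"
    using parent[of "p ! ?s"] cyc[OF i(1)] i lt by simp
  moreover have "p ! ?t = butlast m"
    using parent[of "p ! ?t"] cyc[OF lt(2)] t i lt by (simp add: insert_commute)
  ultimately have "?s = ?t" using dist lt nth_eq_iff_index_eq by metis
  moreover have "?s \<noteq> ?t"
  proof (cases i)
    case 0
    then show ?thesis using len by simp
  next
    case (Suc j)
    then have "?t = j" using i(1) len
      by (metis Suc_lessD add_Suc add_diff_cancel_left' mod_add_self2 mod_less plus_1_eq_Suc)
    moreover have "?s = (if Suc i = ?n then 0 else Suc i)" using i by simp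
    ultimately show ?thesis using Suc i len by auto
  qed
  ultimately show False by simp
qed

text \<open>Two vertices are joined by the path that turns at their longest common prefix;
  \<open>conv\<close> keeps it inside \<open>W\<close>.\<close>

lemma is_tree_tree_on:
  assumes "w \<in> W" and above: "\<And>v. v \<in> W \<Longrightarrow> prefix w v"
    and conv: "\<And>u v. v \<in> W \<Longrightarrow> prefix w u \<Longrightarrow> prefix u v \<Longrightarrow> u \<in> W"
  shows "is_tree (tree_on W)"
proof -
  have "\<exists>p. is_path (tree_on W) p \<and> hd p = u \<and> last p = v" if uv: "u \<in> W" "v \<in> W" for u v
  proof -
    let ?x = "longest_common_prefix u v"
    have x: "prefix ?x u" "prefix ?x v" "prefix w ?x"
      using above[OF uv(1)] above[OF uv(2)]
      by (simp_all add: longest_common_prefix_prefix1 longest_common_prefix_prefix2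
          longest_common_prefix_max_prefix)
    have "w' = ?x" if "prefix ?x w'" "prefix w' u" "prefix w' v" for w'
      using that longest_common_prefix_max_prefix[of w' u v] by (simp add: prefix_order.antisym)
    from turning_path[OF x(1,2) this] obtain p where p: "p \<noteq> []" "distinct p" "hd p = u" "last p = v"
      "set p = {w. prefix ?x w \<and> (prefix w u \<or> prefix w v)}"
      "successively (\<lambda>u v. (\<exists>b. v = u @ [b]) \<or> (\<exists>b. u = v @ [b])) p"
      by blast
    have "set p \<subseteq> W"
      using p(5) uv x(3) conv prefix_order.trans by blast
    then show ?thesis using p is_path_tree_onI by blast
  qed
  then show ?thesis
    using assms(1) acyclic_tree_on by (auto simp: is_tree_def connected_graph_def)
qed

section \<open>Existence and adjacency of V's and Y's\<close>

text \<open>The prefix condition is true of every V and every Y; including it avoids deriving it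
  from the metric condition \<open>closest_to_root\<close>.\<close>

definition V_at :: "nat \<Rightarrow> bool list ugraph \<Rightarrow> bool list \<Rightarrow> bool list set \<Rightarrow> bool" where
  "V_at n S x E \<longleftrightarrow> is_V n S x E \<and> (\<forall>v\<in>verts S. prefix x v)"

definition Y_at :: "nat \<Rightarrow> bool list ugraph \<Rightarrow> bool list \<Rightarrow> bool list set \<Rightarrow> bool" where
  "Y_at n S x U \<longleftrightarrow> is_Y n S x U \<and> (\<forall>v\<in>verts S. prefix x v)"

lemma closest_to_rootI:
  assumes "x \<in> verts S" "\<And>v. v \<in> verts S \<Longrightarrow> prefix x v \<and> length v \<le> n"
  shows "closest_to_root n S x"
  using assms graph_dist_bin_tree prefix_length_le unfolding closest_to_root_def by metis

lemma prefix_branches: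
  assumes "prefix (x @ [b]) y" "prefix (x @ [\<not> b]) z" "prefix w y" "prefix w z"
  shows "prefix w x"
proof -
  have "\<not> prefix (x @ [b]) w"
  proof
    assume "prefix (x @ [b]) w"
    then have "prefix (x @ [b]) z" using assms(4) prefix_order.trans by blast
    then show False using assms(2) by (auto simp: prefix_def)
  qed
  then show ?thesis
    using assms(1,3) prefix_same_cases[of w y "x @ [b]"] by (auto simp: prefix_snoc)
qed

lemma V_at_exists:
  assumes "prefix (x @ [b]) y" "prefix (x @ [\<not> b]) z" "length y \<le> n" "length z \<le> n"
  shows "\<exists>S. V_at n S x {y, z}"
proof -
  have xy: "prefix x y" "prefix x z" "x \<noteq> y" "x \<noteq> z"
    using assms(1,2) by (auto simp: prefix_def)
  have "w = x" if "prefix x w" "prefix w y" "prefix w z" for w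
    using prefix_branches[OF assms(1,2) that(2,3)] that(1) by (simp add: prefix_order.antisym)
  from turning_path[OF xy(1,2) this] obtain p where p: "p \<noteq> []" "distinct p" "hd p = y" "last p = z"
    "set p = {w. prefix x w \<and> (prefix w y \<or> prefix w z)}"
    "successively (\<lambda>u v. (\<exists>b. v = u @ [b]) \<or> (\<exists>b. u = v @ [b])) p"
    by blast
  have len: "length v \<le> n" if "v \<in> set p" for v
    using that p(5) assms(3,4) by (auto dest!: prefix_length_le)
  have "is_path (bin_tree n) p"
    unfolding bin_tree_eq_tree_on using p len by (intro is_path_tree_onI) auto
  moreover have "y \<noteq> z"
    using prefix_branches[OF assms(1,2), of y] xy by (auto intro: prefix_order.antisym)
  moreover have "closest_to_root n (path_graph p) x"
    by (rule closest_to_rootI) (use p(5) xy len in \<open>auto simp: path_graph_def\<close>)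
  ultimately have "is_V n (path_graph p) x {y, z}"
    unfolding is_V_def using p xy by blast
  then show ?thesis
    unfolding V_at_def using p(5) by (intro exI[of _ "path_graph p"]) (auto simp: path_graph_def)
qed

text \<open>The Y is the union of the ascending paths from \<open>w\<close> to \<open>y\<close> and
  to \<open>z\<close>, which part at \<open>x\<close>. Since \<open>w\<close> is strictly below
  \<open>x\<close>, both leave \<open>w\<close> by the same edge, so \<open>w\<close> is a leaf;
  every vertex other than \<open>w\<close>, \<open>y\<close>, \<open>z\<close> has a parent and a
  child in the union.\<close>

lemma Y_at_exists:
  assumes wx: "strict_prefix w x"
    and y: "prefix (x @ [b]) y" "length y \<le> n" and z: "prefix (x @ [\<not> b]) z" "length z \<le> n"
  shows "\<exists>S. Y_at n S w {y, z}"
proof -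
  define W where "W = {v. prefix w v \<and> (prefix v y \<or> prefix v z)}"
  let ?S = "tree_on W"
  have xy: "prefix x y" "prefix x z" "x \<noteq> y" "x \<noteq> z"
    using y z by (auto simp: prefix_def)
  have wyz: "prefix w y" "prefix w z" "w \<noteq> y" "w \<noteq> z"
    using wx xy by (meson prefix_order.less_le_trans prefix_order.less_imp_le prefix_order.less_irrefl)+
  have incomp: "\<not> prefix y z" "\<not> prefix z y"
    using prefix_branches[OF y(1) z(1), of y] prefix_branches[OF y(1) z(1), of z] xy
    by (auto intro: prefix_order.antisym)
  have W: "w \<in> W" "y \<in> W" "z \<in> W" using wyz by (auto simp: W_def)
  have len: "length v \<le> n" if "v \<in> W" for v
    using that y z by (auto simp: W_def dest!: prefix_length_le)
  have tree: "is_tree ?S"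
    by (rule is_tree_tree_on[of w]) (use W in \<open>auto simp: W_def intro: prefix_order.trans\<close>)
  have deg: "{e \<in> edges ?S. v \<in> e} =
      {{v, v @ [c]} | c. v \<in> W \<and> v @ [c] \<in> W} \<union> {{u, v} | u c. v = u @ [c] \<and> u \<in> W \<and> v \<in> W}" for v
    by (auto simp: tree_on_def)
  have parent: "\<exists>u c. v = u @ [c] \<and> u \<in> W" if "v \<in> W" "v \<noteq> w" for v
  proof -
    from that obtain vs where vs: "v = w @ vs" "vs \<noteq> []" by (auto simp: W_def prefix_def)
    then have "v = (w @ butlast vs) @ [last vs]" by simp
    moreover have "w @ butlast vs \<in> W"
      using \<open>v \<in> W\<close> calculation unfolding W_def
      by (metis (no_types, lifting) mem_Collect_eq prefixI prefix_order.trans)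
    ultimately show ?thesis by blast
  qed
  have child: "\<exists>c. v @ [c] \<in> W" if "v \<in> W" "v \<noteq> y" "v \<noteq> z" for v
  proof -
    from that obtain q where q: "q \<in> {y, z}" "prefix v q" "v \<noteq> q" "prefix w v"
      by (auto simp: W_def)
    obtain c where "prefix (v @ [c]) q" using q(2,3) by (rule prefix_one_step)
    then have "v @ [c] \<in> W" using q(1,4) by (auto simp: W_def)
    then show ?thesis ..
  qed
  have leaves: "leaves ?S = {w, y, z}"
  proof (intro equalityI subsetI)
    fix v assume v: "v \<in> leaves ?S"
    then have vW: "v \<in> W" and "card {e \<in> edges ?S. v \<in> e} = 1" by (auto simp: leaves_def)
    then obtain e where e: "{e \<in> edges ?S. v \<in> e} = {e}" using card_1_singletonE by blast
    show "v \<in> {w, y, z}"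
    proof (rule ccontr)
      assume "v \<notin> {w, y, z}"
      with parent[OF vW] child[OF vW] obtain u c d
        where uc: "v = u @ [c]" "u \<in> W" and d: "v @ [d] \<in> W" by auto
      have "{v, v @ [d]} \<in> {e}" "{u, v} \<in> {e}"
        unfolding e[symmetric] deg using uc d vW by blast+
      then have "{v, v @ [d]} = {u, v}" by simp
      then show False using uc by (auto simp: doubleton_eq_iff)
    qed
  next
    fix v assume "v \<in> {w, y, z}"
    moreover have "w \<in> leaves ?S"
    proof -
      obtain c where c: "prefix (w @ [c]) x"
        using wx prefix_one_step[of w x] by (auto simp: strict_prefix_def)
      have cW: "w @ [c] \<in> W" using c xy by (auto simp: W_def intro: prefix_order.trans)
      have "d = c" if "w @ [d] \<in> W" for d
      proof -
        from that have "prefix (w @ [d]) y \<or> prefix (w @ [d]) z" by (auto simp: W_def)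
        moreover have "prefix (w @ [c]) y" "prefix (w @ [c]) z"
          using c xy prefix_order.trans by blast+
        ultimately have "w @ [d] = w @ [c]"
          by (metis length_append_singleton prefix_length_prefix prefix_order.antisym order_refl)
        then show ?thesis by simp
      qed
      moreover have "u @ [d] \<noteq> w" if "u \<in> W" for u d
        using that by (auto simp: W_def dest!: prefix_length_le)
      ultimately have "{{w, w @ [d]} | d. w \<in> W \<and> w @ [d] \<in> W} = {{w, w @ [c]}}"
        "{{u, w} | u d. w = u @ [d] \<and> u \<in> W \<and> w \<in> W} = {}"
        using W(1) cW by blast+
      then have "{e \<in> edges ?S. w \<in> e} = {{w, w @ [c]}}"
        unfolding deg by (simp only: Un_empty_right)
      then show ?thesis using W by (simp add: leaves_def)
    qed
    moreover have "q \<in> leaves ?S" if q: "q \<in> {y, z}" for q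
    proof -
      have qW: "q \<in> W" "q \<noteq> w" using q W wyz by auto
      obtain u c where u: "q = u @ [c]" "u \<in> W" using parent[OF qW] by blast
      have "q @ [d] \<notin> W" for d
      proof
        assume "q @ [d] \<in> W"
        then have "prefix (q @ [d]) y \<or> prefix (q @ [d]) z" by (simp add: W_def)
        then have "prefix q y \<and> q \<noteq> y \<or> prefix q z \<and> q \<noteq> z"
          by (metis append_prefixD not_Cons_self2 append_Nil2 same_append_eq prefix_order.antisym prefixI)
        then show False using q incomp by auto
      qed
      then have "{e \<in> edges ?S. q \<in> e} = {{u, q}}"
        unfolding deg using u qW by auto
      then show ?thesis using qW by (simp add: leaves_def)
    qed
    ultimately show "v \<in> leaves ?S" by auto
  qed
  have "subgraph ?S (bin_tree n)"
    unfolding subgraph_def wf_ugraph_def bin_tree_eq_tree_on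
  proof (intro conjI)
    show "\<forall>e\<in>edges ?S. e \<subseteq> verts ?S \<and> card e = 2"
      by (auto simp: tree_on_def)
    show "edges ?S \<subseteq> edges (tree_on {x. length x \<le> n})"
    proof
      fix e assume "e \<in> edges ?S"
      then obtain v b where e: "e = {v, v @ [b]}" "v \<in> W" "v @ [b] \<in> W"
        by (auto simp: tree_on_def)
      then show "e \<in> edges (tree_on {x. length x \<le> n})"
        using len[OF e(2)] len[OF e(3)] unfolding e(1) by (simp add: tree_on_edge_iff)
    qed
  qed (use len in auto)
  moreover have "card (leaves ?S) = 3"
    unfolding leaves using wyz incomp by auto
  moreover have "closest_to_root n ?S w"
    by (rule closest_to_rootI) (use W len in \<open>auto simp: W_def\<close>)
  ultimately have "is_Y n ?S w {y, z}"
    unfolding is_Y_def using tree leaves wyz by auto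
  then show ?thesis
    unfolding Y_at_def by (intro exI[of _ ?S]) (auto simp: W_def)
qed

section \<open>Vertices and edges of \<open>VY_graph\<close>\<close>

lemma V_at_vert: "V_at n S x E \<Longrightarrow> S \<in> verts (VY_graph n)"
  by (auto simp: V_at_def VY_graph_def)

lemma Y_at_vert: "Y_at n S x U \<Longrightarrow> S \<in> verts (VY_graph n)"
  by (auto simp: Y_at_def VY_graph_def)

lemma V_at_tips:
  assumes "V_at n S x E"
  shows "x \<in> verts S" "\<And>v. v \<in> verts S \<Longrightarrow> prefix x v" "\<And>y. y \<in> E \<Longrightarrow> strict_prefix x y"
  using assms
  by (auto simp: V_at_def is_V_def closest_to_root_def path_graph_def is_path_def strict_prefix_def)

lemma Y_at_tips:
  assumes "Y_at n S x U"
  shows "x \<in> verts S" "\<And>v. v \<in> verts S \<Longrightarrow> prefix x v" "\<And>y. y \<in> U \<Longrightarrow> strict_prefix x y"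
  using assms
  by (auto simp: Y_at_def is_Y_def closest_to_root_def leaves_def strict_prefix_def)

text \<open>Edges of \<open>VY_graph\<close> join distinct vertices by definition, so each adjacency
  needs this: the low point \<open>x\<close> of \<open>S\<close> is not a vertex of
  \<open>S'\<close>.\<close>

lemma distinct_if_low_above:
  assumes "x \<in> verts S" "strict_prefix x y" "\<And>v. v \<in> verts S' \<Longrightarrow> prefix y v"
  shows "S \<noteq> S'"
  using assms prefix_order.less_le_not_le by blast

lemma VV_edge:
  assumes "V_at n S x E" "V_at n S' y E'" "y \<in> E"
  shows "{S, S'} \<in> edges (VY_graph n)"
proof -
  have "S \<noteq> S'"
    using distinct_if_low_above V_at_tips[OF assms(1)] V_at_tips[OF assms(2)] assms(3) by metis
  moreover have "VV_adj n S S'" using assms unfolding VV_adj_def V_at_def by blast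
  ultimately show ?thesis unfolding VY_graph_def by auto
qed

lemma YV_edge:
  assumes "Y_at n S x U" "V_at n S' y E'" "y \<in> U"
  shows "{S, S'} \<in> edges (VY_graph n)"
proof -
  have "S \<noteq> S'"
    using distinct_if_low_above Y_at_tips[OF assms(1)] V_at_tips[OF assms(2)] assms(3) by metis
  moreover have "YV_adj n S S'" using assms unfolding YV_adj_def V_at_def Y_at_def by blast
  ultimately show ?thesis unfolding VY_graph_def by auto
qed

lemma YY_edge:
  assumes "Y_at n S x U" "Y_at n S' y U'" "y \<in> U"
  shows "{S, S'} \<in> edges (VY_graph n)"
proof -
  have "S \<noteq> S'"
    using distinct_if_low_above Y_at_tips[OF assms(1)] Y_at_tips[OF assms(2)] assms(3) by metis
  moreover have "YY_adj n S S'" using assms unfolding YY_adj_def Y_at_def by blast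
  ultimately show ?thesis unfolding VY_graph_def by auto
qed


section \<open>Binary trees embedded in a set of vertices\<close>

text \<open>\<open>A\<close> contains, above \<open>p\<close>, the image of a complete binary tree with \<open>k\<close> levels under
  a map that sends the two subtrees of each vertex to different sides of its image.\<close>

fun branching :: "nat \<Rightarrow> bool list set \<Rightarrow> bool list \<Rightarrow> bool" where
  "branching 0 A p \<longleftrightarrow> True"
| "branching (Suc k) A p \<longleftrightarrow>
     (\<exists>x\<in>A. prefix p x \<and> branching k A (x @ [False]) \<and> branching k A (x @ [True]))"

lemma branching_SucE:
  assumes "branching (Suc k) A p"
  obtains x where "x \<in> A" "prefix p x" "\<forall>b. branching k A (x @ [b])"
  using assms by (auto intro: that simp: all_bool_eq)

lemma branching_SucI:
  "x \<in> A \<Longrightarrow> prefix p x \<Longrightarrow> (\<And>b. branching k A (x @ [b])) \<Longrightarrow> branching (Suc k) A p"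
  by auto

lemma branching_mono: "branching k A p \<Longrightarrow> A \<subseteq> B \<Longrightarrow> branching k B p"
  by (induction k arbitrary: p) auto

lemma branching_prefix: "branching k A q \<Longrightarrow> prefix p q \<Longrightarrow> branching k A p"
  by (cases k) (auto intro: prefix_order.trans)

lemma branching_all:
  "length p + k \<le> n \<Longrightarrow> branching k {x. length x < n} p"
  by (induction k arbitrary: p) (auto intro!: exI)

lemma branching_fewer_levels: "branching (k + l) A p \<Longrightarrow> branching k A p"
  by (induction k arbitrary: p) auto

text \<open>The vertex Ramsey property. If the root \<open>x\<close> of the tree is in
  \<open>A\<close>, then either one side contains the tree in \<open>B\<close>, or both sides
  contain trees in \<open>A\<close> with \<open>k - 1\<close> levels, which \<open>x\<close> joins;
  likewise for \<open>B\<close>.\<close>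

lemma branching_Un:
  assumes "branching (k + l) (A \<union> B) p"
  shows "branching k A p \<or> branching l B p"
  using assms
proof (induction "k + l" arbitrary: k l p rule: less_induct)
  case less
  show ?case
  proof (cases "k = 0 \<or> l = 0")
    case True
    then show ?thesis by (elim disjE) simp_all
  next
    case False
    then obtain k' l' where kl: "k = Suc k'" "l = Suc l'" by (auto simp: gr0_conv_Suc)
    from less.prems obtain x where x: "x \<in> A \<union> B" "prefix p x"
      and sides: "\<forall>b. branching (k' + l) (A \<union> B) (x @ [b])"
      unfolding kl(1) add_Suc by (elim branching_SucE)
    have px: "prefix p (x @ [b])" for b using x(2) by simp
    from x(1) show ?thesis
    proof
      assume "x \<in> A"
      have "branching k' A (x @ [b]) \<or> branching l B (x @ [b])" for b
        using less.hyps[OF _ sides[rule_format]] kl by simp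
      then show ?thesis
        using branching_SucI[OF \<open>x \<in> A\<close> x(2), of k'] branching_prefix[OF _ px] kl(1) by blast
    next
      assume "x \<in> B"
      have "branching (k + l') (A \<union> B) (x @ [b])" for b using sides kl by simp
      then have "branching k A (x @ [b]) \<or> branching l' B (x @ [b])" for b
        using less.hyps[of k l' "x @ [b]"] kl by simp
      then show ?thesis
        using branching_SucI[OF \<open>x \<in> B\<close> x(2), of l'] branching_prefix[OF _ px] kl(2) by blast
    qed
  qed
qed

text \<open>The chain always continues on the \<open>False\<close> side, so the \<open>True\<close>
  side of each entry stays free for the second endpoint of a V.\<close>

lemma branching_chain:
  assumes "branching m A p"
  shows "\<exists>xs. length xs = m \<and> set xs \<subseteq> {x\<in>A. prefix p x} \<and> sorted_wrt (\<lambda>x y. prefix (x @ [False]) y) xs"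
  using assms
proof (induction m arbitrary: p)
  case (Suc m)
  then obtain x where x: "x \<in> A" "prefix p x" "branching m A (x @ [False])"
    by (elim branching_SucE) blast
  from Suc.IH[OF x(3)] obtain xs where xs: "length xs = m" "set xs \<subseteq> {y\<in>A. prefix (x @ [False]) y}"
    "sorted_wrt (\<lambda>x y. prefix (x @ [False]) y) xs" by blast
  have "prefix p y" if "prefix (x @ [False]) y" for y
    using that x(2) by (meson append_prefixD prefix_order.trans)
  then show ?case using x xs by (intro exI[of _ "x # xs"]) auto
qed simp

text \<open>Each tree gives up its root. If the roots \<open>y\<close> and \<open>z\<close> are
  comparable, the lower one separates; otherwise the vertex where they part does.\<close>

lemma branching_split:
  assumes "branching (Suc k) A p" "branching (Suc k) B p"
  obtains x b where "prefix p x" "branching k A (x @ [b])" "branching k B (x @ [\<not> b])"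
proof -
  obtain y where y: "y \<in> A" "prefix p y" "\<forall>b. branching k A (y @ [b])"
    using assms(1) by (elim branching_SucE)
  obtain z where z: "z \<in> B" "prefix p z" "\<forall>b. branching k B (z @ [b])"
    using assms(2) by (elim branching_SucE)
  have below: "branching k C q" if "\<forall>b. branching k C (v @ [b])" "prefix q v" for C q v
    using that(1)[rule_format, of True] by (rule branching_prefix) (use that(2) in simp)
  consider "y = z" | "prefix y z" "y \<noteq> z" | "prefix z y" "z \<noteq> y" | "y \<parallel> z"
    by (auto simp: parallel_def)
  then show thesis
  proof cases
    case 1
    then show ?thesis using that[of y True] y z by simp
  next
    case 2
    then obtain c where "prefix (y @ [c]) z" by (rule prefix_one_step)
    then show ?thesis using that[of y "\<not> c"] y below[OF z(3)] by simp
  next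
    case 3
    then obtain c where "prefix (z @ [c]) y" by (rule prefix_one_step)
    then show ?thesis using that[of z c] z below[OF y(3)] by simp
  next
    case 4
    from parallel_decomp[OF 4] obtain as b bs c cs
      where eq: "b \<noteq> c" "y = as @ b # bs" "z = as @ c # cs" by (elim exE conjE)
    have "c = (\<not> b)" using eq(1) by simp
    then have pre: "prefix (as @ [b]) y" "prefix (as @ [\<not> b]) z"
      unfolding eq(2,3) by (simp_all add: prefix_def)
    then have "prefix p as" using prefix_branches[OF pre y(2) z(2)] by simp
    then show ?thesis using that[of as b] below[OF y(3) pre(1)] below[OF z(3) pre(2)] by simp
  qed
qed

section \<open>Path-decompositions with bags of small chromatic number\<close>

text \<open>The classical bound for shift graphs: the sets \<open>C i\<close> of colours on pairs
  beginning with \<open>i\<close> are distinct, since \<open>c (f i j)\<close> lies in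
  \<open>C i\<close> but not in \<open>C j\<close>, and there are only \<open>2 ^ r\<close> sets of
  colours.\<close>

lemma shift_graph_colouring:
  fixes m :: nat
  assumes "\<And>i j. i < j \<Longrightarrow> j < m \<Longrightarrow> f i j \<in> verts G \<inter> X"
    and "\<And>i j k. i < j \<Longrightarrow> j < k \<Longrightarrow> k < m \<Longrightarrow> {f i j, f j k} \<in> edges G"
    and col: "proper_colouring (induced G X) r c"
  shows "m \<le> 2 ^ r"
proof -
  define C where "C i = {c (f i j) | j. i < j \<and> j < m}" for i
  have neq: "C i \<noteq> C j" if "i < j" "j < m" for i j
  proof
    assume "C i = C j"
    then have "c (f i j) \<in> C j" using that by (auto simp: C_def)
    then obtain k where k: "j < k" "k < m" "c (f i j) = c (f j k)" by (auto simp: C_def)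
    have "f i j \<in> verts G \<inter> X" "f j k \<in> verts G \<inter> X" "{f i j, f j k} \<in> edges G"
      using assms(1)[of i j] assms(1)[of j k] assms(2)[of i j k] that k by auto
    then have "c (f i j) \<noteq> c (f j k)"
      using col by (auto simp: proper_colouring_def induced_def)
    with k show False by simp
  qed
  have "inj_on C {..<m}"
    using neq by (auto simp: inj_on_def linorder_neq_iff) (metis linorder_neqE_nat)
  moreover have "C ` {..<m} \<subseteq> Pow {..<r}"
    using assms(1) col by (auto simp: C_def proper_colouring_def induced_def)
  ultimately have "card {..<m} \<le> card (Pow {..<r})"
    by (intro card_inj_on_le) auto
  then show ?thesis by (simp add: card_Pow)
qed

text \<open>\<open>k + (k + Suc (2 ^ r))\<close> levels suffice for \<open>switching_time\<close>, which is applied twice to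
  gain one element of a chain.\<close>

fun levels :: "nat \<Rightarrow> nat \<Rightarrow> nat" where
  "levels r 0 = 0"
| "levels r (Suc m) =
     (let split = (\<lambda>k. k + (k + Suc (2 ^ r))) in Suc (split (split (Suc (Suc (levels r m))))))"

section \<open>Times at which V's and Y's are active\<close>

locale colourable_bags =
  fixes n r :: nat and Bs :: "bool list ugraph set list"
  assumes decomposition: "path_decomposition (VY_graph n) Bs"
    and colourable: "\<And>t. t < length Bs \<Longrightarrow> \<exists>c. proper_colouring (induced (VY_graph n) (Bs ! t)) r c"
begin

definition active :: "bool list ugraph \<Rightarrow> nat \<Rightarrow> bool" where
  "active S t \<longleftrightarrow> t < length Bs \<and> S \<in> Bs ! t"

text \<open>\<open>ends_by t\<close> and \<open>starts_from t\<close> consist of the vertices that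
  are early and late at \<open>t\<close>. Different V's may be the witnesses, so the two sets can
  overlap.\<close>

definition ends_by :: "nat \<Rightarrow> bool list set" where
  "ends_by t = {x. \<exists>S E. V_at n S x E \<and> (\<forall>s. active S s \<longrightarrow> s \<le> t)}"

definition starts_from :: "nat \<Rightarrow> bool list set" where
  "starts_from t = {x. \<exists>S E. V_at n S x E \<and> (\<forall>s. active S s \<longrightarrow> t \<le> s)}"

lemma active_convex:
  assumes "S \<in> verts (VY_graph n)" "active S s" "active S u" "s \<le> t" "t \<le> u"
  shows "active S t"
proof -
  have "\<forall>s t u. s \<le> t \<and> t \<le> u \<and> u < length Bs \<and> S \<in> Bs ! s \<and> S \<in> Bs ! u \<longrightarrow> S \<in> Bs ! t"
    using decomposition assms(1) unfolding path_decomposition_def by blast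
  then show ?thesis using assms unfolding active_def by (meson le_less_trans)
qed

lemma edge_active:
  assumes "{S, S'} \<in> edges (VY_graph n)"
  shows "\<exists>t. active S t \<and> active S' t"
proof -
  have "\<forall>e\<in>edges (VY_graph n). \<exists>t<length Bs. e \<subseteq> Bs ! t"
    using decomposition unfolding path_decomposition_def by (elim conjE)
  from bspec[OF this assms] show ?thesis unfolding active_def by auto
qed

lemma shift_active:
  fixes m :: nat
  assumes "\<And>i j. i < j \<Longrightarrow> j < m \<Longrightarrow> f i j \<in> verts (VY_graph n) \<and> active (f i j) t"
    and "\<And>i j k. i < j \<Longrightarrow> j < k \<Longrightarrow> k < m \<Longrightarrow> {f i j, f j k} \<in> edges (VY_graph n)"
  shows "m \<le> 2 ^ r"
\<comment> \<open>Without a pair of indices \<open>t\<close> need not be a time of the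
  decomposition, but then the bound is trivial.\<close>
proof (cases "m \<le> 1")
  case True
  then show ?thesis using one_le_power[of "2::nat" r] by linarith
next
  case False
  then have "t < length Bs" using assms(1)[of 0 1] by (simp add: active_def)
  then obtain c where "proper_colouring (induced (VY_graph n) (Bs ! t)) r c"
    using colourable by blast
  then show ?thesis
    using assms by (intro shift_graph_colouring[of m f "VY_graph n" "Bs ! t"]) (auto simp: active_def)
qed

text \<open>The V with low point \<open>xs ! i\<close> and endpoint \<open>xs ! j\<close> stands for
  the pair \<open>(i, j)\<close> of a shift graph inside the bag at \<open>t\<close>.\<close>

lemma no_long_active_V_chain:
  assumes "branching m A p" and A: "\<And>x. x \<in> A \<Longrightarrow> length x < n"
    and act: "\<And>x S E. x \<in> A \<Longrightarrow> V_at n S x E \<Longrightarrow> active S t"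
  shows "m \<le> 2 ^ r"
proof -
  obtain xs where xs: "length xs = m" "set xs \<subseteq> {x\<in>A. prefix p x}"
    "sorted_wrt (\<lambda>x y. prefix (x @ [False]) y) xs"
    using branching_chain[OF assms(1)] by blast
  have inA: "xs ! i \<in> A" if "i < m" for i using that xs(1,2) nth_mem[of i xs] by blast
  define f where "f i j = (SOME S. V_at n S (xs ! i) {xs ! j, xs ! i @ [True]})" for i j
  have f: "V_at n (f i j) (xs ! i) {xs ! j, xs ! i @ [True]}" if "i < j" "j < m" for i j
  proof -
    have "prefix (xs ! i @ [False]) (xs ! j)"
      using xs(1,3) that by (auto simp: sorted_wrt_iff_nth_less)
    then have "\<exists>S. V_at n S (xs ! i) {xs ! j, xs ! i @ [True]}"
      using A[OF inA[of i]] A[OF inA[of j]] that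
      by (intro V_at_exists[where b = False]) auto
    then show ?thesis unfolding f_def by (rule someI_ex)
  qed
  show ?thesis
  proof (rule shift_active[of m f t])
    show "f i j \<in> verts (VY_graph n) \<and> active (f i j) t" if "i < j" "j < m" for i j
      using f[OF that] V_at_vert act[OF inA[of i]] that by auto
    show "{f i j, f j k} \<in> edges (VY_graph n)" if "i < j" "j < k" "k < m" for i j k
      using VV_edge[OF f[of i j] f[of j k]] that by auto
  qed
qed

text \<open>The number \<open>t\<close> is the first time at which the vertices in \<open>ends_by t\<close> are branching. Just
  before it, the Ramsey property of trees leaves only the vertices in \<open>starts_from t\<close>,
  or a long chain of vertices whose V's are all active at \<open>t\<close>.\<close>

lemma switching_time:
  assumes "branching (k + (k + Suc (2 ^ r))) A p" and A: "\<And>x. x \<in> A \<Longrightarrow> length x < n"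
    and lohi: "lo \<le> hi" "A \<subseteq> starts_from lo" "A \<subseteq> ends_by hi"
  obtains t where "lo \<le> t" "t \<le> hi" "branching k (A \<inter> ends_by t) p" "branching k (A \<inter> starts_from t) p"
proof -
  have big: "branching k A p"
    using assms(1) by (rule branching_fewer_levels)
  let ?P = "\<lambda>t. lo \<le> t \<and> branching k (A \<inter> ends_by t) p"
  define t where "t = (LEAST t. ?P t)"
  have hi: "?P hi" using lohi big by (simp add: Int_absorb2)
  have t: "?P t" "t \<le> hi"
    unfolding t_def by (rule LeastI[of ?P, OF hi], rule Least_le[of ?P, OF hi])
  have "branching k (A \<inter> starts_from t) p"
  proof (cases "t = lo")
    case True
    then show ?thesis using big lohi by (simp add: Int_absorb2)
  next
    case False
    then have before: "lo \<le> t - 1" "t - 1 < t" using t(1) by auto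
    then have "\<not> ?P (t - 1)" unfolding t_def using not_less_Least by blast
    then have noL: "\<not> branching k (A \<inter> ends_by (t - 1)) p" using before by simp
    \<comment> \<open>Every V with low point in \<open>?N\<close> is active at some time before
      \<open>t\<close> and at some time from \<open>t\<close> on, hence at \<open>t\<close>.\<close>
    let ?N = "A - ends_by (t - 1) - starts_from t"
    have "A \<subseteq> (A \<inter> ends_by (t - 1)) \<union> ((A \<inter> starts_from t) \<union> ?N)" by blast
    from branching_Un[OF branching_mono[OF assms(1) this]]
    have "branching (k + Suc (2 ^ r)) ((A \<inter> starts_from t) \<union> ?N) p"
      using noL by blast
    moreover have "\<not> branching (Suc (2 ^ r)) ?N p"
    proof
      assume *: "branching (Suc (2 ^ r)) ?N p"
      have "active S t" if N: "x \<in> ?N" and V: "V_at n S x E" for x S E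
      proof -
        have "x \<notin> starts_from t" "x \<notin> ends_by (t - 1)" using N by blast+
        then obtain s u where "active S s" "\<not> t \<le> s" "active S u" "\<not> u \<le> t - 1"
          using V unfolding starts_from_def ends_by_def by blast
        then show ?thesis using active_convex[OF V_at_vert[OF V], of s u t] by simp
      qed
      from no_long_active_V_chain[OF * _ this] A show False by auto
    qed
    ultimately show ?thesis using branching_Un by blast
  qed
  with t show ?thesis using that by blast
qed

section \<open>Y's with a given upper or lowest leaf\<close>

definition early_upper :: "bool list \<Rightarrow> nat \<Rightarrow> bool" where
  "early_upper y t \<longleftrightarrow>
     (\<forall>S x U u. Y_at n S x U \<and> y \<in> U \<and> active S u \<and> t \<le> u \<longrightarrow> active S t)"

definition late_lowest :: "bool list \<Rightarrow> nat \<Rightarrow> bool" where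
  "late_lowest y t \<longleftrightarrow>
     (\<forall>S U u. Y_at n S y U \<and> active S u \<and> u \<le> t \<longrightarrow> active S t)"

text \<open>If both fail, some Y with upper leaf \<open>y\<close> lives only after \<open>t\<close>
  and some Y with lowest leaf \<open>y\<close> only before \<open>t\<close>; but these two are
  adjacent and share a bag.\<close>

lemma early_upper_or_late_lowest: "early_upper y t \<or> late_lowest y t"
proof (rule ccontr)
  assume "\<not> ?thesis"
  then obtain S x U u S' U' u' where Y: "Y_at n S x U" "y \<in> U" "active S u" "t \<le> u" "\<not> active S t"
    and Y': "Y_at n S' y U'" "active S' u'" "u' \<le> t" "\<not> active S' t"
    unfolding early_upper_def late_lowest_def by blast
  obtain s where s: "active S s" "active S' s"
    using edge_active[OF YY_edge[OF Y(1) Y'(1) Y(2)]] by blast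
  show False
  proof (cases "s \<le> t")
    case True
    then show False using active_convex[OF Y_at_vert[OF Y(1)] s(1) Y(3) True Y(4)] Y(5) by simp
  next
    case False
    then show False using active_convex[OF Y_at_vert[OF Y'(1)] Y'(2) s(2) Y'(3)] Y'(4) by simp
  qed
qed

text \<open>The Y shares a bag with a V at \<open>y\<close> that is over by \<open>u\<close> and one
  with a V at \<open>z\<close> that starts no sooner than \<open>u\<close>.\<close>

lemma Y_active_between:
  assumes Y: "Y_at n S w U" "y \<in> U" "z \<in> U" and "y \<in> ends_by u" "z \<in> starts_from u"
  shows "active S u"
proof -
  obtain S1 E1 where V1: "V_at n S1 y E1" "\<And>s. active S1 s \<Longrightarrow> s \<le> u"
    using assms(4) unfolding ends_by_def by blast
  obtain S2 E2 where V2: "V_at n S2 z E2" "\<And>s. active S2 s \<Longrightarrow> u \<le> s"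
    using assms(5) unfolding starts_from_def by blast
  obtain s1 where "active S s1" "s1 \<le> u"
    using edge_active[OF YV_edge[OF Y(1) V1(1) Y(2)]] V1(2) by blast
  moreover obtain s2 where "active S s2" "u \<le> s2"
    using edge_active[OF YV_edge[OF Y(1) V2(1) Y(3)]] V2(2) by blast
  ultimately show ?thesis using active_convex[OF Y_at_vert[OF Y(1)]] by blast
qed

lemma splitting_vertex:
  assumes "branching (Suc (Suc k) + (Suc (Suc k) + Suc (2 ^ r))) A p"
    and A: "\<And>x. x \<in> A \<Longrightarrow> length x < n"
    and lohi: "lo \<le> hi" "A \<subseteq> starts_from lo" "A \<subseteq> ends_by hi"
  obtains x b u where "prefix p x" "lo \<le> u" "u \<le> hi"
    "branching (Suc k) (A \<inter> ends_by u) (x @ [b])" "branching (Suc k) (A \<inter> starts_from u) (x @ [\<not> b])"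
proof -
  obtain u where "lo \<le> u" "u \<le> hi"
    "branching (Suc (Suc k)) (A \<inter> ends_by u) p" "branching (Suc (Suc k)) (A \<inter> starts_from u) p"
    using switching_time[OF assms] by blast
  then show ?thesis using branching_split[of "Suc k"] that by metis
qed

text \<open>In both alternatives of \<open>early_upper_or_late_lowest\<close> the Y from \<open>y\<close> to \<open>y'\<close> is active
  throughout the inner of the two nested intervals.\<close>

definition linked :: "bool list \<times> nat \<times> nat \<Rightarrow> bool list \<times> nat \<times> nat \<Rightarrow> bool" where
  "linked = (\<lambda>(y, l, h) (y', l', h'). l \<le> l' \<and> h' \<le> h \<and>
     (\<exists>S U. Y_at n S y U \<and> y' \<in> U \<and> (\<forall>t. l' \<le> t \<and> t \<le> h' \<longrightarrow> active S t)))"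

text \<open>The Y with upper leaves \<open>z\<close>, early at \<open>u\<close>, and
  \<open>y'\<close>, late at \<open>u\<close>, is active at \<open>u\<close>. As its lowest leaf is
  \<open>y\<close>, it is active at \<open>s\<close> too, hence on all of
  \<open>[u, s]\<close>.\<close>

lemma linked_if_late_lowest:
  assumes late: "late_lowest y s" and "u \<le> s" and yx: "strict_prefix y x"
    and z: "prefix (x @ [b]) z" "length z < n" "z \<in> ends_by u"
    and y': "prefix (x @ [\<not> b]) y'" "length y' < n" "y' \<in> starts_from u"
    and "u \<le> l'" "h' \<le> s"
  shows "linked (y, u, s) (y', l', h')"
proof -
  obtain S where S: "Y_at n S y {z, y'}"
    using Y_at_exists[OF yx z(1) less_imp_le[OF z(2)] y'(1) less_imp_le[OF y'(2)]] by blast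
  have "active S u" using Y_active_between[OF S _ _ z(3) y'(3)] by simp
  moreover from this have "active S s" using late S \<open>u \<le> s\<close> unfolding late_lowest_def by blast
  ultimately have "active S t" if "l' \<le> t" "t \<le> h'" for t
    using active_convex[OF Y_at_vert[OF S], of u s t] that assms(10,11) by simp
  then show ?thesis unfolding linked_def using S assms(10,11) by blast
qed

text \<open>The mirror image, except that the alternative is used at the upper leaf
  \<open>y'\<close>: the Y, active at \<open>u\<close>, is active back to \<open>l'\<close>. Hence
  \<open>long_chain\<close> records \<open>early_upper\<close> for the entries at their left
  ends.\<close>

lemma linked_if_early_upper:
  assumes early: "early_upper y' l'" and yx: "strict_prefix y x"
    and y': "prefix (x @ [b]) y'" "length y' < n" "y' \<in> ends_by u"
    and z: "prefix (x @ [\<not> b]) z" "length z < n" "z \<in> starts_from u"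
    and "s \<le> l'" "l' \<le> h'" "h' \<le> u"
  shows "linked (y, s, u) (y', l', h')"
proof -
  obtain S where S: "Y_at n S y {y', z}"
    using Y_at_exists[OF yx y'(1) less_imp_le[OF y'(2)] z(1) less_imp_le[OF z(2)]] by blast
  have u: "active S u" using Y_active_between[OF S _ _ y'(3) z(3)] by simp
  moreover from this have "active S l'"
    using early S assms(9-11) le_trans unfolding early_upper_def by blast
  ultimately have "active S t" if "l' \<le> t" "t \<le> h'" for t
    using active_convex[OF Y_at_vert[OF S], of l' u t] that assms(9-11) by simp
  then show ?thesis unfolding linked_def using S assms(9-11) by blast
qed

text \<open>\<open>sorted_wrt\<close> demands \<open>linked\<close> for all pairs of entries, not
  just consecutive ones, because the shift graph needs a Y for each pair.\<close>

definition chain_in ::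
  "bool list set \<Rightarrow> bool list \<Rightarrow> nat \<Rightarrow> nat \<Rightarrow> (bool list \<times> nat \<times> nat) list \<Rightarrow> bool" where
  "chain_in A p lo hi cs \<longleftrightarrow>
     sorted_wrt linked cs \<and>
     (\<forall>(y, l, h)\<in>set cs. y \<in> A \<and> prefix p y \<and> lo \<le> l \<and> l \<le> h \<and> h \<le> hi)"

lemma chain_in_mono:
  assumes "chain_in A p lo hi cs" "A \<subseteq> A'" "prefix p' p" "lo' \<le> lo" "hi \<le> hi'"
  shows "chain_in A' p' lo' hi' cs"
  unfolding chain_in_def
proof (intro conjI ballI)
  show "sorted_wrt linked cs" using assms(1) by (simp add: chain_in_def)
  fix q assume q: "q \<in> set cs"
  obtain y l h where ylh: "q = (y, l, h)" by (cases q)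
  have "y \<in> A" "prefix p y" "lo \<le> l" "l \<le> h" "h \<le> hi"
    using assms(1) q unfolding chain_in_def ylh by auto
  then show "case q of (y, l, h) \<Rightarrow> y \<in> A' \<and> prefix p' y \<and> lo' \<le> l \<and> l \<le> h \<and> h \<le> hi'"
    unfolding ylh using assms(2-) prefix_order.trans[OF assms(3)] by auto
qed

text \<open>Each step finds a vertex \<open>y\<close> with one of the two alternatives. In the late
  case it extends a tail counted by \<open>a\<close>, in the early case a tail counted by
  \<open>b\<close>, whose entries are all early; a tail that has already reached the other goal is
  kept as it is.\<close>

lemma long_chain:
  assumes "branching (levels r (a + b)) A p" and "\<And>x. x \<in> A \<Longrightarrow> length x < n"
    and "lo \<le> hi" "A \<subseteq> starts_from lo" "A \<subseteq> ends_by hi"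
  shows "\<exists>cs. chain_in A p lo hi cs \<and>
    (length cs = a \<or> length cs = b \<and> (\<forall>(y, l, h)\<in>set cs. early_upper y l))"
  using assms
proof (induction "a + b" arbitrary: a b A p lo hi)
  case 0
  then show ?case by (intro exI[of _ "[]"]) (auto simp: chain_in_def)
next
  case (Suc m)
  show ?case
  proof (cases "a = 0 \<or> b = 0")
    case True
    then show ?thesis by (intro exI[of _ "[]"]) (auto simp: chain_in_def)
  next
    case False
    \<comment> \<open>Of the two extra levels inside, one is spent on separating the early tree from
      the late one, the other provides the second upper leaf \<open>z\<close>.\<close>
    define k where "k = Suc (Suc (levels r m)) + (Suc (Suc (levels r m)) + Suc (2 ^ r))"
    have "branching (Suc (k + (k + Suc (2 ^ r)))) A p"
      using Suc.prems(1) unfolding Suc.hyps(2)[symmetric] k_def levels.simps Let_def .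
    then obtain y where y: "y \<in> A" "prefix p y"
      and up: "\<forall>c. branching (k + (k + Suc (2 ^ r))) A (y @ [c])" by (elim branching_SucE)
    obtain s where s: "lo \<le> s" "s \<le> hi" "branching k (A \<inter> ends_by s) (y @ [True])"
      "branching k (A \<inter> starts_from s) (y @ [True])"
      using switching_time[OF up[rule_format] Suc.prems(2-)] by blast
    have above: "strict_prefix y x" "\<And>c. prefix p (x @ [c])" if "prefix (y @ [True]) x" for x
      using that y(2) by (auto simp: prefix_def strict_prefix_def)
    show ?thesis
    proof (cases "late_lowest y s")
      case True
      \<comment> \<open>Among the vertices early at \<open>s\<close>, the new switching time
        \<open>u\<close> is at most \<open>s\<close>; the tail then uses those late at
        \<open>u\<close>, within \<open>[u, s]\<close>.\<close>
      let ?A = "A \<inter> ends_by s"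
      obtain x c u where x: "prefix (y @ [True]) x" "lo \<le> u" "u \<le> s"
        "branching (Suc (levels r m)) (?A \<inter> ends_by u) (x @ [c])"
        "branching (Suc (levels r m)) (?A \<inter> starts_from u) (x @ [\<not> c])"
        by (rule splitting_vertex[OF s(3)[unfolded k_def], of lo s]) (use Suc.prems(2-) s in auto)
      obtain z where z: "z \<in> ?A \<inter> ends_by u" "prefix (x @ [c]) z"
        using x(4) by (elim branching_SucE)
      let ?A' = "?A \<inter> starts_from u"
      obtain a' where a': "a = Suc a'" using False by (cases a) auto
      have m: "m = a' + b" using Suc.hyps(2) a' by simp
      have "branching (levels r (a' + b)) ?A' (x @ [\<not> c])"
        using branching_fewer_levels[OF x(5)[unfolded Suc_eq_plus1]] unfolding m .
      from Suc.hyps(1)[OF m this] obtain cs where cs: "chain_in ?A' (x @ [\<not> c]) u s cs"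
        "length cs = a' \<or> length cs = b \<and> (\<forall>(y, l, h)\<in>set cs. early_upper y l)"
        using Suc.prems(2) x(3) by blast
      have up': "chain_in A p lo hi cs"
        using chain_in_mono[OF cs(1)] above(2)[OF x(1)] x(2) s(2) by blast
      have "linked (y, u, s) q" if "q \<in> set cs" for q
      proof -
        obtain y' l' h' where q: "q = (y', l', h')" by (cases q)
        with that cs(1) have "y' \<in> ?A'" "prefix (x @ [\<not> c]) y'" "u \<le> l'" "h' \<le> s"
          unfolding chain_in_def by auto
        then show ?thesis unfolding q using z Suc.prems(2)
          by (intro linked_if_late_lowest[OF True x(3) above(1)[OF x(1)] z(2)]) auto
      qed
      then have "chain_in A p lo hi ((y, u, s) # cs)"
        using up' y x s unfolding chain_in_def by auto
      then show ?thesis using up' cs(2) a' by (metis length_Cons)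
    next
      case False': False
      then have early: "early_upper y s" using early_upper_or_late_lowest by blast
      \<comment> \<open>Symmetrically, \<open>u\<close> is now at least \<open>s\<close>, and the
        tail uses vertices early at \<open>u\<close>, within \<open>[s, u]\<close>.\<close>
      let ?A = "A \<inter> starts_from s"
      obtain x c u where x: "prefix (y @ [True]) x" "s \<le> u" "u \<le> hi"
        "branching (Suc (levels r m)) (?A \<inter> ends_by u) (x @ [c])"
        "branching (Suc (levels r m)) (?A \<inter> starts_from u) (x @ [\<not> c])"
        by (rule splitting_vertex[OF s(4)[unfolded k_def], of s hi]) (use Suc.prems(2-) s in auto)
      obtain z where z: "z \<in> ?A \<inter> starts_from u" "prefix (x @ [\<not> c]) z"
        using x(5) by (elim branching_SucE)
      let ?A' = "?A \<inter> ends_by u"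
      obtain b' where b': "b = Suc b'" using False by (cases b) auto
      have m: "m = a + b'" using Suc.hyps(2) b' by simp
      have "branching (levels r (a + b')) ?A' (x @ [c])"
        using branching_fewer_levels[OF x(4)[unfolded Suc_eq_plus1]] unfolding m .
      from Suc.hyps(1)[OF m this] obtain cs where cs: "chain_in ?A' (x @ [c]) s u cs"
        "length cs = a \<or> length cs = b' \<and> (\<forall>(y, l, h)\<in>set cs. early_upper y l)"
        using Suc.prems(2) x(2) by blast
      have up': "chain_in A p lo hi cs"
        using chain_in_mono[OF cs(1)] above(2)[OF x(1)] x(3) s(1) by blast
      show ?thesis
      proof (cases "length cs = a")
        case True
        then show ?thesis using up' by blast
      next
        case False
        then have cs_early: "length cs = b'" "\<forall>(y, l, h)\<in>set cs. early_upper y l"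
          using cs(2) by auto
        have "linked (y, s, u) q" if "q \<in> set cs" for q
        proof -
          obtain y' l' h' where q: "q = (y', l', h')" by (cases q)
          with that cs(1) have "y' \<in> ?A'" "prefix (x @ [c]) y'" "s \<le> l'" "l' \<le> h'" "h' \<le> u"
            unfolding chain_in_def by auto
          moreover have "early_upper y' l'" using cs_early that q by auto
          ultimately show ?thesis unfolding q using z Suc.prems(2)
            by (intro linked_if_early_upper[OF _ above(1)[OF x(1)] _ _ _ z(2)]) auto
        qed
        then have "chain_in A p lo hi ((y, s, u) # cs)"
          using up' y x s unfolding chain_in_def by auto
        moreover have "\<forall>(y, l, h)\<in>set ((y, s, u) # cs). early_upper y l"
          using early cs_early by auto
        ultimately show ?thesis using cs_early(1) b' by (metis length_Cons)
      qed
    qed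
  qed
qed

text \<open>The intervals are nested, so the left end \<open>?t\<close> of the last one lies in all
  of them. The Y's linking the entries are all active then and form a shift graph.\<close>

lemma chain_length_le:
  assumes "chain_in A p lo hi cs"
  shows "length cs \<le> 2 ^ r"
proof (cases "cs = []")
  case False
  let ?m = "length cs"
  define y where "y i = fst (cs ! i)" for i
  define l where "l i = fst (snd (cs ! i))" for i
  define h where "h i = snd (snd (cs ! i))" for i
  let ?t = "l (?m - 1)"
  have cs_nth: "cs ! i = (y i, l i, h i)" for i by (simp add: y_def l_def h_def)
  have lh: "l i \<le> h i" if "i < ?m" for i
    using assms that nth_mem[OF that] unfolding chain_in_def cs_nth by auto
  have link: "linked (y i, l i, h i) (y j, l j, h j)" if "i < j" "j < ?m" for i j
    using assms that unfolding chain_in_def sorted_wrt_iff_nth_less cs_nth by blast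
  have t: "l j \<le> ?t" "?t \<le> h j" if "j < ?m" for j
  proof -
    have "l j \<le> l (?m - 1) \<and> h (?m - 1) \<le> h j"
    proof (cases "j = ?m - 1")
      case False
      then have "j < ?m - 1" "?m - 1 < ?m" using that by auto
      then show ?thesis using link[of j "?m - 1"] by (simp add: linked_def)
    qed simp
    moreover have "l (?m - 1) \<le> h (?m - 1)" using that by (intro lh) simp
    ultimately show "l j \<le> ?t" "?t \<le> h j" by simp_all
  qed
  have "\<exists>S U. Y_at n S (y i) U \<and> y j \<in> U \<and> active S ?t" if "i < j" "j < ?m" for i j
    using link[OF that] t[OF that(2)] unfolding linked_def by blast
  then obtain f U where f: "\<And>i j. i < j \<Longrightarrow> j < ?m \<Longrightarrow> Y_at n (f i j) (y i) (U i j) \<and>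
      y j \<in> U i j \<and> active (f i j) ?t" by metis
  show ?thesis
  proof (rule shift_active[of ?m f ?t])
    show "f i j \<in> verts (VY_graph n) \<and> active (f i j) ?t" if "i < j" "j < ?m" for i j
      using f[OF that] Y_at_vert by blast
    show "{f i j, f j k} \<in> edges (VY_graph n)" if "i < j" "j < k" "k < ?m" for i j k
      using f[of i j] f[of j k] that YY_edge by (meson less_trans)
  qed
qed simp

lemma height_bound: "n < levels r (2 * Suc (2 ^ r))"
proof (rule ccontr)
  let ?M = "Suc (2 ^ r)" and ?A = "{x :: bool list. length x < n}"
  assume "\<not> n < levels r (2 * ?M)"
  then have "length [] + levels r (?M + ?M) \<le> n"
    unfolding mult_2 by (simp only: list.size add_0 not_less)
  then have big: "branching (levels r (?M + ?M)) ?A []" by (rule branching_all)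
  \<comment> \<open>Since \<open>length x < n\<close>, both children of \<open>x\<close> are in the
    tree and \<open>x\<close> is the low point of a V, which trivially starts no sooner than
    \<open>0\<close> and ends by \<open>length Bs\<close>.\<close>
  have "\<exists>S E. V_at n S x E" if "length x < n" for x
    using V_at_exists[of x True "x @ [True]" "x @ [False]" n] that by auto
  then have "?A \<subseteq> starts_from 0" "?A \<subseteq> ends_by (length Bs)"
    by (auto simp: starts_from_def ends_by_def active_def intro: less_imp_le)
  with long_chain[OF big, of 0 "length Bs"]
  obtain cs where "chain_in ?A [] 0 (length Bs) cs" "length cs = ?M" by blast
  then show False using chain_length_le[of ?A "[]" 0 "length Bs" cs] by simp
qed

end

section \<open>The path-chromatic number\<close>

text \<open>Finiteness provides a colouring of every bag, so that the \<open>LEAST\<close> in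
  \<open>chromatic_number\<close> is attained.\<close>

lemma finite_verts_VY_graph: "finite (verts (VY_graph n))"
proof (rule finite_subset)
  let ?X = "{x :: bool list. length x \<le> n}"
  have "finite ?X" using finite_lists_length_le[of "UNIV :: bool set" n] by simp
  then show "finite ((\<lambda>(W, F). UGraph W F) ` (Pow ?X \<times> Pow (Pow ?X)))" by simp
  have *: "S \<in> (\<lambda>(W, F). UGraph W F) ` (Pow ?X \<times> Pow (Pow ?X))"
    if "verts S \<subseteq> ?X" "\<And>e. e \<in> edges S \<Longrightarrow> e \<subseteq> verts S" for S
    using that by (intro image_eqI[of _ _ "(verts S, edges S)"]) auto
  show "verts (VY_graph n) \<subseteq> (\<lambda>(W, F). UGraph W F) ` (Pow ?X \<times> Pow (Pow ?X))"
  proof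
    fix S assume "S \<in> verts (VY_graph n)"
    then consider x E where "is_V n S x E" | x U where "is_Y n S x U"
      unfolding VY_graph_def by auto
    then show "S \<in> (\<lambda>(W, F). UGraph W F) ` (Pow ?X \<times> Pow (Pow ?X))"
    proof cases
      case 1
      then obtain p where p: "is_path (bin_tree n) p" "S = path_graph p"
        unfolding is_V_def by blast
      show ?thesis
        by (rule *) (use p in \<open>auto simp: path_graph_def is_path_def bin_tree_def\<close>)
    next
      case 2
      then have "subgraph S (bin_tree n)" unfolding is_Y_def by blast
      then show ?thesis
        by (intro *) (auto simp: subgraph_def wf_ugraph_def bin_tree_def)
    qed
  qed
qed

lemma proper_colouring_exists:
  assumes "finite (verts G)" "\<And>v. {v, v} \<notin> edges G"
  shows "\<exists>k c. proper_colouring G k c"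
proof -
  obtain c and k :: nat where c: "c ` verts G = {i. i < k}" "inj_on c (verts G)"
    using finite_imp_inj_to_nat_seg[OF assms(1)] by blast
  then have "proper_colouring G k c"
    unfolding proper_colouring_def using assms(2) inj_on_eq_iff[OF c(2)] by fastforce
  then show ?thesis by blast
qed

lemma proper_colouring_of_chromatic_number:
  assumes "finite (verts G)" "\<And>v. {v, v} \<notin> edges G" "chromatic_number G \<le> r"
  shows "\<exists>c. proper_colouring G r c"
proof -
  have "\<exists>c. proper_colouring G (chromatic_number G) c"
    unfolding chromatic_number_def using proper_colouring_exists[OF assms(1,2)] by (rule LeastI_ex)
  then show ?thesis using assms(3) unfolding proper_colouring_def by (meson less_le_trans)
qed

lemma path_decomposition_exists:
  assumes "\<And>e. e \<in> edges G \<Longrightarrow> e \<subseteq> verts G"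
  shows "path_decomposition G [verts G]"
  using assms by (simp add: path_decomposition_def)

lemma VY_graph_edge_subset:
  assumes "e \<in> edges (VY_graph n)"
  shows "e \<subseteq> verts (VY_graph n)"
  using assms unfolding VY_graph_def VV_adj_def YY_adj_def YV_adj_def by auto

lemma VY_graph_no_loop: "{v, v} \<notin> edges (VY_graph n)"
  by (auto simp: VY_graph_def doubleton_eq_iff)

lemma colourable_bags_if_pchr_le:
  assumes "pchr (VY_graph n) \<le> r"
  shows "\<exists>Bs. colourable_bags n r Bs"
proof -
  let ?G = "VY_graph n"
  \<comment> \<open>The decomposition with a single bag ensures that the \<open>LEAST\<close> in
    \<open>pchr\<close> is attained.\<close>
  have "path_decomposition ?G [verts ?G]"
    using VY_graph_edge_subset by (rule path_decomposition_exists)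
  then have "\<exists>k Bs. path_decomposition ?G Bs \<and> decomposition_chr ?G Bs = k" by blast
  then have "\<exists>Bs. path_decomposition ?G Bs \<and> decomposition_chr ?G Bs = pchr ?G"
    unfolding pchr_def by (rule LeastI_ex)
  then obtain Bs where Bs: "path_decomposition ?G Bs" "decomposition_chr ?G Bs \<le> r"
    using assms by auto
  have "\<exists>c. proper_colouring (induced ?G (Bs ! t)) r c" if "t < length Bs" for t
  proof (rule proper_colouring_of_chromatic_number)
    show "finite (verts (induced ?G (Bs ! t)))"
      using finite_verts_VY_graph by (simp add: induced_def)
    show "{v, v} \<notin> edges (induced ?G (Bs ! t))" for v
      using VY_graph_no_loop[of v n] by (simp add: induced_def)
    have "chromatic_number (induced ?G (Bs ! t)) \<le> decomposition_chr ?G Bs"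
      unfolding decomposition_chr_def using that by (intro Max_ge) auto
    then show "chromatic_number (induced ?G (Bs ! t)) \<le> r" using Bs(2) by simp
  qed
  with Bs(1) have "colourable_bags n r Bs" by unfold_locales
  then show ?thesis by blast
qed

theorem theorem3:
  fixes r :: nat
  assumes "r > 0"
  shows "\<exists>n0>0. \<forall>n\<ge>n0. pchr (VY_graph n) > r"
proof (intro exI conjI allI impI)
  let ?N = "Suc (levels r (2 * Suc (2 ^ r)))"
  show "?N > 0" by simp
  fix n assume n: "n \<ge> ?N"
  show "pchr (VY_graph n) > r"
  proof (rule ccontr)
    assume "\<not> pchr (VY_graph n) > r"
    then obtain Bs where "colourable_bags n r Bs"
      using colourable_bags_if_pchr_le[of n r] by auto
    then have "n < levels r (2 * Suc (2 ^ r))"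
      by (rule colourable_bags.height_bound)
    with n show False by simp
  qed
qed

end
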